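(* The finite difference schemes $MA^{M}$ and $MA^{\delta}$ (for every $\delta>0$) are degenerate elliptic; that is, at each grid point $x_i$, each of $MA^{M}[u]_i$ and $MA^{\delta}[u]_i$ is a function of the differences $u_j-u_i$ ($j\ne i$) between neighboring values and the reference value $u_i$, and is non-decreasing in each of these differences.
   Context: Work in $\mathbb{R}^d$ on a Cartesian grid with spacing $h>0$; a grid function $u$ has values $u_i=u(x_i)$. $\mathcal{G}$ denotes a finite set of $d$-tuples $(\nu_1,\dots,\nu_d)$ of mutually orthogonal nonzero vectors lying on the grid (integer vectors, so that $x_i\pm\nu_jh$ are grid points). Discrete second directional derivatives: $$\mathcal{D}_{\nu\nu}u_i=\frac{1}{|\nu|^2h^2}\bigl(u(x_i+\nu h)+u(x_i-\nu h)-2u(x_i)\bigr).$$ At grid points near the boundary of the domain where $x_i+\nu h$ or $x_i-\nu h$ lies outside the domain, the missing values are replaced by (interpolated) boundary values at the points where the line in direction $\nu$ through $x_i$ meets the boundary: if $\rho_\pm>0$ are the distances from $x_i$ to the points $x_i^\pm$ used in the directions $\pm\nu$, then $\mathcal{D}_{\nu\nu}u_i=\frac{2}{\rho_++\rho_-}\left(\frac{u(x_i^+)-u(x_i)}{\rho_+}+\frac{u(x_i^-)-u(x_i)}{\rho_-}\right)$; the values $u(x_i^\pm)$ then count among the neighboring values $u_j$. Monotone scheme. With $a^+=\max(a,0)$, $$MA^{M}[u]_i=\min_{(\nu_1,\dots,\nu_d)\in\mathcal{G}}\ \prod_{j=1}^d\left(\mathcal{D}_{\nu_j\nu_j}u_i\right)^+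 .$$ Regularized scheme. For $\delta>0$ put $${\max}^\delta(a,b)=\tfrac12\left(a+b+\sqrt{(a-b)^2+\delta^2}\right),\qquad {\min}^\delta(a,b)=\tfrac12\left(a+b-\sqrt{(a-b)^2+\delta^2}\right).$$ If $\mathcal{G}=\{\nu^1,\dots,\nu^K\}$ and $p_k=\prod_{j=1}^d{\max}^\delta(\mathcal{D}_{\nu^k_j\nu^k_j}u_i,0)$, set $m_1=p_1$, $m_k={\min}^\delta(m_{k-1},p_k)$ for $2\le k\le K$, and $MA^\delta[u]_i=m_K$. *)

theory Defs
  imports "HOL-Analysis.Analysis"
begin

definition grid :: "real^'n \<Rightarrow> real \<Rightarrow> (real^'n) set" where
  "grid x0 h = {x0 + h *\<^sub>R k | k. \<forall>i. k $ i \<in> \<int>}"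

text \<open>Since the tuples have \<open>d\<close> entries in \<open>d\<close>-dimensional space, they are indexed by the
  coordinate type \<open>'n\<close>, where \<open>d = CARD('n)\<close>.\<close>

definition orthogonal_grid_tuple :: "('n \<Rightarrow> real^'n) \<Rightarrow> bool" where
  "orthogonal_grid_tuple \<nu> \<longleftrightarrow>
     (\<forall>j i. \<nu> j $ i \<in> \<int>) \<and> (\<forall>j. \<nu> j \<noteq> 0) \<and> (\<forall>j k. j \<noteq> k \<longrightarrow> orthogonal (\<nu> j) (\<nu> k))"

text \<open>The point used at \<open>x\<close> in direction \<open>v\<close>: the grid point \<open>x + h v\<close> if it lies in the domain
  \<open>\<Omega>\<close>, and otherwise the first point at which the ray from \<open>x\<close> in direction \<open>v\<close> meets the boundary
  of \<open>\<Omega>\<close>. For open \<open>\<Omega>\<close> containing \<open>x\<close> the infimum is attained and positive, see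
  \<open>stencil_point_cases\<close>.\<close>

definition stencil_point :: "(real^'n) set \<Rightarrow> real \<Rightarrow> real^'n \<Rightarrow> real^'n \<Rightarrow> real^'n" where
  "stencil_point \<Omega> h x v =
     (if x + h *\<^sub>R v \<in> \<Omega> then x + h *\<^sub>R v
      else x + Inf {t. 0 < t \<and> x + t *\<^sub>R v \<in> frontier \<Omega>} *\<^sub>R v)"

lemma stencil_point_cases:
  assumes "open \<Omega>" "x \<in> \<Omega>" "0 < h" "x + h *\<^sub>R v \<notin> \<Omega>"
  obtains t where "0 < t" "t \<le> h" "stencil_point \<Omega> h x v = x + t *\<^sub>R v"
    "x + t *\<^sub>R v \<in> frontier \<Omega>" "\<And>s. 0 < s \<Longrightarrow> s < t \<Longrightarrow> x + s *\<^sub>R v \<notin> frontier \<Omega>"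
proof -
  define T where "T = {t. 0 < t \<and> x + t *\<^sub>R v \<in> frontier \<Omega>}"
  have x: "x \<notin> frontier \<Omega>"
    using assms frontier_disjoint_eq by blast
  have cont: "continuous_on UNIV (\<lambda>t. x + t *\<^sub>R v)"
    by (intro continuous_intros)
  have "T = {0..} \<inter> (\<lambda>t. x + t *\<^sub>R v) -` frontier \<Omega>"
    using x by (auto simp: T_def order_le_less)
  then have "closed T"
    using cont by (auto intro!: closed_Int closed_vimage simp: continuous_on_eq_continuous_at)
  have "connected ((\<lambda>t. x + t *\<^sub>R v) ` {0..h})"
    by (intro connected_continuous_image continuous_intros) auto
  moreover have "x \<in> (\<lambda>t. x + t *\<^sub>R v) ` {0..h}" "x + h *\<^sub>R v \<in> (\<lambda>t. x + t *\<^sub>R v) ` {0..h}"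
    using \<open>0 < h\<close> by (auto intro: image_eqI[of _ _ 0])
  ultimately have "(\<lambda>t. x + t *\<^sub>R v) ` {0..h} \<inter> frontier \<Omega> \<noteq> {}"
    using assms by (intro connected_Int_frontier) auto
  then obtain t0 where "0 \<le> t0" "t0 \<le> h" "x + t0 *\<^sub>R v \<in> frontier \<Omega>"
    by auto
  then have t0: "t0 \<in> T" "t0 \<le> h"
    using x by (auto simp: T_def order_le_less)
  have bdd: "bdd_below T"
    by (auto simp: T_def intro: bdd_belowI[of _ 0])
  have "Inf T \<in> T"
    using t0 bdd \<open>closed T\<close> by (intro closed_contains_Inf) auto
  moreover have "Inf T \<le> h"
    using cInf_lower[OF t0(1) bdd] t0(2) by simp
  moreover have "x + s *\<^sub>R v \<notin> frontier \<Omega>" if "0 < s" "s < Inf T" for s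
    using cInf_lower[of s T] bdd that by (auto simp: T_def)
  ultimately show thesis
    using that[of "Inf T"] assms(4) by (auto simp: T_def stencil_point_def)
qed

text \<open>A grid function is modelled as a function on the whole space, of which only the values at grid
  points in \<open>\<Omega>\<close> and the (interpolated) values at boundary points enter the schemes.\<close>

definition second_diff ::
    "(real^'n) set \<Rightarrow> real \<Rightarrow> real^'n \<Rightarrow> (real^'n \<Rightarrow> real) \<Rightarrow> real^'n \<Rightarrow> real" where
  "second_diff \<Omega> h v u x =
     (if x + h *\<^sub>R v \<in> \<Omega> \<and> x - h *\<^sub>R v \<in> \<Omega>
      then 1 / ((norm v)\<^sup>2 * h\<^sup>2) * (u (x + h *\<^sub>R v) + u (x - h *\<^sub>R v) - 2 * u x)
      else let xp = stencil_point \<Omega> h x v; xm = stencil_point \<Omega> h x (- v);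
               \<rho>p = dist x xp; \<rho>m = dist x xm
           in 2 / (\<rho>p + \<rho>m) * ((u xp - u x) / \<rho>p + (u xm - u x) / \<rho>m))"

definition MA_M ::
    "(real^'n) set \<Rightarrow> real \<Rightarrow> ('n \<Rightarrow> real^'n) set \<Rightarrow> (real^'n \<Rightarrow> real) \<Rightarrow> real^'n \<Rightarrow> real" where
  "MA_M \<Omega> h G u x = Min ((\<lambda>\<nu>. \<Prod>j\<in>UNIV. max (second_diff \<Omega> h (\<nu> j) u x) 0) ` G)"

definition max_reg :: "real \<Rightarrow> real \<Rightarrow> real \<Rightarrow> real" where
  "max_reg \<delta> a b = (a + b + sqrt ((a - b)\<^sup>2 + \<delta>\<^sup>2)) / 2"

definition min_reg :: "real \<Rightarrow> real \<Rightarrow> real \<Rightarrow> real" where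
  "min_reg \<delta> a b = (a + b - sqrt ((a - b)\<^sup>2 + \<delta>\<^sup>2)) / 2"

definition reg_prod ::
    "(real^'n) set \<Rightarrow> real \<Rightarrow> real \<Rightarrow> ('n \<Rightarrow> real^'n) \<Rightarrow> (real^'n \<Rightarrow> real) \<Rightarrow> real^'n \<Rightarrow> real" where
  "reg_prod \<Omega> h \<delta> \<nu> u x = (\<Prod>j\<in>UNIV. max_reg \<delta> (second_diff \<Omega> h (\<nu> j) u x) 0)"

text \<open>The operation \<open>min_reg\<close> is not associative, so the regularized scheme depends on the
  enumeration \<open>\<nu>s\<close> of the set of tuples. The fold computes \<open>m\<^sub>1 = p\<^sub>1\<close> and
  \<open>m\<^sub>k = min_reg \<delta> m\<^sub>k\<^sub>-\<^sub>1 p\<^sub>k\<close>; it is meant for nonempty \<open>\<nu>s\<close> only.\<close>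

definition MA_reg ::
    "(real^'n) set \<Rightarrow> real \<Rightarrow> real \<Rightarrow> ('n \<Rightarrow> real^'n) list \<Rightarrow> (real^'n \<Rightarrow> real) \<Rightarrow> real^'n \<Rightarrow> real"
where
  "MA_reg \<Omega> h \<delta> \<nu>s u x =
     foldl (min_reg \<delta>) (reg_prod \<Omega> h \<delta> (hd \<nu>s) u x) (map (\<lambda>\<nu>. reg_prod \<Omega> h \<delta> \<nu> u x) (tl \<nu>s))"

definition neighbors ::
    "(real^'n) set \<Rightarrow> real \<Rightarrow> ('n \<Rightarrow> real^'n) set \<Rightarrow> real^'n \<Rightarrow> (real^'n) set" where
  "neighbors \<Omega> h G x =
     (\<Union>\<nu>\<in>G. \<Union>j. {stencil_point \<Omega> h x (\<nu> j), stencil_point \<Omega> h x (- \<nu> j)})"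

text \<open>\<open>N x\<close> is the set of neighbors of \<open>x\<close>. The function \<open>\<Phi>\<close>, which may vary with \<open>x\<close>, receives
  the family of differences indexed by \<open>N x\<close> only.\<close>

definition degenerate_elliptic ::
    "'p set \<Rightarrow> ('p \<Rightarrow> 'p set) \<Rightarrow> (('p \<Rightarrow> real) \<Rightarrow> 'p \<Rightarrow> real) \<Rightarrow> bool" where
  "degenerate_elliptic X N F \<longleftrightarrow>
     (\<forall>x\<in>X. finite (N x) \<and> x \<notin> N x \<and>
       (\<exists>\<Phi>. (\<forall>u. F u x = \<Phi> (\<lambda>y\<in>N x. u y - u x)) \<and>
            (\<forall>w. \<forall>y\<in>N x. mono (\<lambda>t. \<Phi> (w(y := t))))))"

end

theory Submission
  imports Defs
begin

text \<open>Every second difference is a combination, with nonnegative weights, of the differences between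
  the two stencil values and the reference value. The schemes combine the second differences through
  functions that are non-decreasing in each argument: products of nonnegative factors, minima, and
  the regularized maximum and minimum, the latter because \<open>s \<mapsto> sqrt (s\<^sup>2 + \<delta>\<^sup>2)\<close> is
  1-Lipschitz.\<close>

text \<open>The witness for \<open>\<Phi>\<close> is the scheme itself, evaluated on the family of differences extended by
  the reference value 0. That the scheme only sees the differences follows from the hypothesis by
  antisymmetry.\<close>

lemma degenerate_ellipticI:
  assumes "\<And>x. x \<in> X \<Longrightarrow> finite (N x)" and "\<And>x. x \<in> X \<Longrightarrow> x \<notin> N x"
    and mono: "\<And>x u w. x \<in> X \<Longrightarrow> (\<And>y. y \<in> N x \<Longrightarrow> u y - u x \<le> w y - w x) \<Longrightarrow> F u x \<le> F w x"
  shows "degenerate_elliptic X N F"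
  unfolding degenerate_elliptic_def
proof (intro ballI conjI exI allI)
  fix x assume x: "x \<in> X"
  show "finite (N x)" and notin: "x \<notin> N x"
    using assms(1,2) x by auto
  let ?\<Phi> = "\<lambda>w. F (w(x := 0)) x"
  show "F u x = ?\<Phi> (\<lambda>y\<in>N x. u y - u x)" for u
    using notin by (intro antisym mono x) auto
  \<comment> \<open>As \<open>x \<notin> N x\<close>, the updated point \<open>y\<close> differs
    from \<open>x\<close>, so the reference value stays 0.\<close>
  show "mono (\<lambda>t. ?\<Phi> (w(y := t)))" if "y \<in> N x" for w y
    using notin that by (intro monoI mono x) auto
qed

lemma second_diff_mono:
  assumes "u (stencil_point \<Omega> h x v) - u x \<le> w (stencil_point \<Omega> h x v) - w x"
    and "u (stencil_point \<Omega> h x (- v)) - u x \<le> w (stencil_point \<Omega> h x (- v)) - w x"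
  shows "second_diff \<Omega> h v u x \<le> second_diff \<Omega> h v w x"
proof (cases "x + h *\<^sub>R v \<in> \<Omega> \<and> x - h *\<^sub>R v \<in> \<Omega>")
  case True
  then have "u (x + h *\<^sub>R v) + u (x - h *\<^sub>R v) - 2 * u x
      \<le> w (x + h *\<^sub>R v) + w (x - h *\<^sub>R v) - 2 * w x"
    using assms by (simp add: stencil_point_def)
  with True show ?thesis
    unfolding second_diff_def by (auto intro!: divide_right_mono)
next
  case False
  with assms show ?thesis
    unfolding second_diff_def Let_def
    \<comment> \<open>The weights are built from distances, hence nonnegative.\<close>
    by (simp only: if_False) (intro mult_left_mono add_mono divide_right_mono; simp)
qed

text \<open>Keeps the reference point out of its own neighborhood: the stencil point lies at a
  positive parameter along a nonzero direction.\<close>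

lemma stencil_point_neq:
  assumes "open \<Omega>" "x \<in> \<Omega>" "0 < h" "v \<noteq> 0"
  shows "stencil_point \<Omega> h x v \<noteq> x"
proof (cases "x + h *\<^sub>R v \<in> \<Omega>")
  case True
  with assms show ?thesis by (simp add: stencil_point_def)
next
  case False
  with assms obtain t where "0 < t" "stencil_point \<Omega> h x v = x + t *\<^sub>R v"
    using stencil_point_cases by metis
  with assms show ?thesis by simp
qed

text \<open>Triangle inequality in the plane for
  \<open>(s, \<delta>) = (t, \<delta>) + (s - t, 0)\<close>.\<close>

lemma sqrt_add_square_lipschitz:
  fixes s t \<delta> :: real
  shows "sqrt (s\<^sup>2 + \<delta>\<^sup>2) \<le> sqrt (t\<^sup>2 + \<delta>\<^sup>2) + \<bar>s - t\<bar>"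
  using real_sqrt_sum_squares_triangle_ineq[of t "s - t" \<delta> 0] by simp

text \<open>The growth of \<open>a + b\<close> bounds the change of \<open>a - b\<close>, hence that
  of the square root.\<close>

lemma max_reg_mono: "a \<le> a' \<Longrightarrow> b \<le> b' \<Longrightarrow> max_reg \<delta> a b \<le> max_reg \<delta> a' b'"
  unfolding max_reg_def
  using sqrt_add_square_lipschitz[of "a - b" \<delta> "a' - b'"] by (simp add: abs_if split: if_splits)

lemma min_reg_mono: "a \<le> a' \<Longrightarrow> b \<le> b' \<Longrightarrow> min_reg \<delta> a b \<le> min_reg \<delta> a' b'"
  unfolding min_reg_def
  \<comment> \<open>The root enters with a minus sign, so primed and unprimed arguments change
    places.\<close>
  using sqrt_add_square_lipschitz[of "a' - b'" \<delta> "a - b"] by (simp add: abs_if split: if_splits)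

text \<open>The root dominates \<open>\<bar>a - b\<bar>\<close>. With \<open>b = 0\<close> this
  makes the factors of \<open>reg_prod\<close> nonnegative, as monotonicity of products
  requires.\<close>

lemma max_reg_ge: "max a b \<le> max_reg \<delta> a b"
proof -
  define r where "r = sqrt ((a - b)\<^sup>2 + \<delta>\<^sup>2)"
  have "\<bar>a - b\<bar> \<le> r"
    unfolding r_def by (rule real_le_rsqrt) simp
  then show ?thesis
    unfolding max_reg_def r_def[symmetric] by (simp add: max_def abs_le_iff)
qed

lemma reg_prod_mono:
  assumes "\<And>j. second_diff \<Omega> h (\<nu> j) u x \<le> second_diff \<Omega> h (\<nu> j) w x"
  shows "reg_prod \<Omega> h \<delta> \<nu> u x \<le> reg_prod \<Omega> h \<delta> \<nu> w x"
  unfolding reg_prod_def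
  using max_reg_ge[of _ 0 \<delta>] assms by (intro prod_mono conjI max_reg_mono) auto

text \<open>For the nested regularized minima: the accumulators change at each list entry, so the
  induction keeps both arbitrary.\<close>

lemma foldl_map_mono:
  fixes f :: "'b::preorder \<Rightarrow> 'c::preorder \<Rightarrow> 'b"
  assumes "\<And>a a' b b'. a \<le> a' \<Longrightarrow> b \<le> b' \<Longrightarrow> f a b \<le> f a' b'"
    and "a \<le> a'" and "\<And>z. z \<in> set zs \<Longrightarrow> p z \<le> q z"
  shows "foldl f a (map p zs) \<le> foldl f a' (map q zs)"
  using assms(2,3) by (induction zs arbitrary: a a') (simp_all add: assms(1))

lemma Min_image_mono:
  fixes f g :: "'a \<Rightarrow> 'b::linorder"
  assumes "finite A" "A \<noteq> {}" "\<And>x. x \<in> A \<Longrightarrow> f x \<le> g x"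
  shows "Min (f ` A) \<le> Min (g ` A)"
  using assms by (auto simp: Min_le_iff intro!: Min.boundedI)

theorem lemma7:
  fixes \<Omega> :: "(real^'n) set" and x0 :: "real^'n" and h :: real
    and G :: "('n \<Rightarrow> real^'n) set"
  assumes "open \<Omega>" and "0 < h"
    and "finite G" and "G \<noteq> {}" and "\<And>\<nu>. \<nu> \<in> G \<Longrightarrow> orthogonal_grid_tuple \<nu>"
  shows "degenerate_elliptic (grid x0 h \<inter> \<Omega>) (neighbors \<Omega> h G) (MA_M \<Omega> h G) \<and>
    (\<forall>\<delta>>0. \<forall>\<nu>s. distinct \<nu>s \<and> set \<nu>s = G \<longrightarrow>
       degenerate_elliptic (grid x0 h \<inter> \<Omega>) (neighbors \<Omega> h G) (MA_reg \<Omega> h \<delta> \<nu>s))"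
proof -
  have fin: "finite (neighbors \<Omega> h G x)" for x
    using assms(3) by (auto simp: neighbors_def)
  have notin: "x \<notin> neighbors \<Omega> h G x" if x: "x \<in> grid x0 h \<inter> \<Omega>" for x
  proof
    assume "x \<in> neighbors \<Omega> h G x"
    then obtain \<nu> j where "\<nu> \<in> G"
      and eq: "x = stencil_point \<Omega> h x (\<nu> j) \<or> x = stencil_point \<Omega> h x (- \<nu> j)"
      by (auto simp: neighbors_def)
    then have "\<nu> j \<noteq> 0"
      using assms(5) by (auto simp: orthogonal_grid_tuple_def)
    with eq x assms(1,2) show False
      using stencil_point_neq[of \<Omega> x h "\<nu> j"] stencil_point_neq[of \<Omega> x h "- \<nu> j"] by auto
  qed
  \<comment> \<open>Both stencil points of every direction in a tuple of \<open>G\<close> are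
    neighbors.\<close>
  have diff_mono: "second_diff \<Omega> h (\<nu> j) u x \<le> second_diff \<Omega> h (\<nu> j) w x"
    if "\<And>y. y \<in> neighbors \<Omega> h G x \<Longrightarrow> u y - u x \<le> w y - w x" "\<nu> \<in> G" for u w x \<nu> j
    using that(2) by (intro second_diff_mono that(1)) (auto simp: neighbors_def)
  show ?thesis
  proof (intro conjI allI impI)
    show "degenerate_elliptic (grid x0 h \<inter> \<Omega>) (neighbors \<Omega> h G) (MA_M \<Omega> h G)"
    proof (rule degenerate_ellipticI[OF fin notin])
      fix x and u w :: "real^'n \<Rightarrow> real"
      assume "\<And>y. y \<in> neighbors \<Omega> h G x \<Longrightarrow> u y - u x \<le> w y - w x"
      then show "MA_M \<Omega> h G u x \<le> MA_M \<Omega> h G w x"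
        unfolding MA_M_def
        by (intro Min_image_mono assms(3,4) prod_mono conjI max.mono diff_mono) auto
    qed
  next
    fix \<delta> :: real and \<nu>s
    assume \<nu>s: "distinct \<nu>s \<and> set \<nu>s = G"
    \<comment> \<open>As \<open>G\<close> is nonempty, so is \<open>\<nu>s\<close>, and
      \<open>hd\<close> yields a genuine tuple.\<close>
    then have "hd \<nu>s \<in> G" "set (tl \<nu>s) \<subseteq> G"
      using assms(4) by (cases \<nu>s; auto)+
    show "degenerate_elliptic (grid x0 h \<inter> \<Omega>) (neighbors \<Omega> h G) (MA_reg \<Omega> h \<delta> \<nu>s)"
    proof (rule degenerate_ellipticI[OF fin notin])
      fix x and u w :: "real^'n \<Rightarrow> real"
      assume "\<And>y. y \<in> neighbors \<Omega> h G x \<Longrightarrow> u y - u x \<le> w y - w x"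
      then show "MA_reg \<Omega> h \<delta> \<nu>s u x \<le> MA_reg \<Omega> h \<delta> \<nu>s w x"
        unfolding MA_reg_def using \<open>hd \<nu>s \<in> G\<close> \<open>set (tl \<nu>s) \<subseteq> G\<close>
        by (intro foldl_map_mono min_reg_mono reg_prod_mono diff_mono) auto
    qed
  qed
qed

end
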